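(* Let $\mathcal{A}$ be an alphabet and let $X\subseteq\Sigma_{\mathcal{A}}$ be a shift space. Then the following are equivalent: (i) $X$ is finite-symbol. (ii) $X^{\mathrm{fin}}=\emptyset$. (iii) $X=X^{\mathrm{inf}}$. (iv) $X^{\mathrm{inf}}$ is a closed subset of $\Sigma_{\mathcal{A}}$. (v) $\vec{0}$ is not a limit point of $X^{\mathrm{inf}}$. (vi) $\vec{0}\notin X$.
   Context: An alphabet is a set $\mathcal{A}$ (finite or infinite); $\mathbb{N}=\{1,2,3,\ldots\}$. Let $\mathcal{A}^0=\{\vec{0}\}$ ($\vec{0}$ the empty sequence), $\Sigma_{\mathcal{A}}^{\mathrm{fin}}=\bigcup_{k=0}^\infty\mathcal{A}^k$ and $\Sigma_{\mathcal{A}}^{\mathrm{inf}}=\mathcal{A}^{\mathbb{N}}$. Let $l(x)\in\{0,1,\ldots,\infty\}$ be the length of a sequence. The full shift $\Sigma_{\mathcal{A}}$: If $\mathcal{A}$ is infinite, $\Sigma_{\mathcal{A}}:=\Sigma_{\mathcal{A}}^{\mathrm{inf}}\sqcup\Sigma_{\mathcal{A}}^{\mathrm{fin}}$, topologized as follows. Let $\mathcal{A}_\infty=\mathcal{A}\cup\{\infty\}$ be the one-point compactification of the discrete space $\mathcal{A}$, let $X_{\mathcal{A}}=\mathcal{A}_\infty\times\mathcal{A}_\infty\times\cdots$ with the product topology, and let $Q:X_{\mathcal{A}}\to\Sigma_{\mathcal{A}}$ truncate a sequence just before the first occurrence of $\infty$ (so $Q(x)=\vec{0}$ if $x_1=\infty$,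 and $Q(x)=x$ if $\infty$ does not occur); give $\Sigma_{\mathcal{A}}$ the quotient topology from $Q$. If $\mathcal{A}$ is finite, $\Sigma_{\mathcal{A}}:=\mathcal{A}^{\mathbb{N}}$ with the product topology, so it contains no finite sequences (in particular it does not contain $\vec 0$, so (v) and (vi) hold trivially in that case). The shift map $\sigma:\Sigma_{\mathcal{A}}\to\Sigma_{\mathcal{A}}$ deletes the first entry of a sequence, with $\sigma(x)=\vec{0}$ if $l(x)\le 1$. A subset $X\subseteq\Sigma_{\mathcal{A}}$ has the infinite-extension property if for every $x\in X$ with $l(x)<\infty$ the set $\{a\in\mathcal{A}: xay\in X\text{ for some }y\in\Sigma_{\mathcal{A}}\}$ is infinite ($xay$ denotes concatenation). A shift space over $\mathcal{A}$ is a subset $X\subseteq\Sigma_{\mathcal{A}}$ that is closed, satisfies $\sigma(X)\subseteq X$, and has the infinite-extension property (the empty set is allowed). Write $X^{\mathrm{inf}}=X\cap\Sigma_{\mathcal{A}}^{\mathrm{inf}}$ and $X^{\mathrm{fin}}=X\cap\Sigma_{\mathcal{A}}^{\mathrm{fin}}$. $B_1(X)\subseteq\mathcal{A}$ is the set of symbols that appear in elements of $X$; $X$ is finite-symbol if $B_1(X)$ is finite. *)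

theory Defs
  imports "HOL-Analysis.Analysis"
begin

text \<open>
  Alphabets are arbitrary sets \<open>A\<close> of type \<^typ>\<open>'a set\<close>, finite (possibly empty) or infinite.
  Infinite sequences are functions on \<^typ>\<open>nat\<close>, so the entry numbered \<open>i\<close> in the
  convention \<open>i = 1, 2, 3, \<dots>\<close> is stored at index \<open>i - 1\<close>.
\<close>

datatype (symbols: 'a) sequence = FinSeq "'a list" | InfSeq "nat \<Rightarrow> 'a"

abbreviation empty_seq :: "'a sequence"
  where "empty_seq \<equiv> FinSeq []"

definition fin_seqs :: "'a set \<Rightarrow> 'a sequence set"
  where "fin_seqs A = FinSeq ` {w. set w \<subseteq> A}"

definition inf_seqs :: "'a set \<Rightarrow> 'a sequence set"
  where "inf_seqs A = InfSeq ` {x. range x \<subseteq> A}"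

definition full_shift :: "'a set \<Rightarrow> 'a sequence set"
  where "full_shift A = (if finite A then inf_seqs A else inf_seqs A \<union> fin_seqs A)"

fun concat_seq :: "'a list \<Rightarrow> 'a sequence \<Rightarrow> 'a sequence"
  where
    "concat_seq w (FinSeq v) = FinSeq (w @ v)"
  | "concat_seq w (InfSeq y) = InfSeq (\<lambda>n. if n < length w then w ! n else y (n - length w))"

text \<open>Here \<open>tl [] = []\<close> gives \<open>shift_map empty_seq = empty_seq\<close>.\<close>

fun shift_map :: "'a sequence \<Rightarrow> 'a sequence"
  where
    "shift_map (FinSeq w) = FinSeq (tl w)"
  | "shift_map (InfSeq x) = InfSeq (\<lambda>n. x (Suc n))"

text \<open>
  The library's Alexandroff compactification lives on \<^typ>\<open>'a option\<close>; \<^const>\<open>None\<close> is the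
  added point \<open>\<infinity>\<close>.
\<close>

definition extended_shift_topology :: "'a set \<Rightarrow> (nat \<Rightarrow> 'a option) topology"
  where "extended_shift_topology A =
    product_topology (\<lambda>_. Alexandroff_compactification (discrete_topology A)) UNIV"

definition truncate_seq :: "(nat \<Rightarrow> 'a option) \<Rightarrow> 'a sequence"
  where "truncate_seq x =
    (if \<exists>n. x n = None
     then FinSeq (map (\<lambda>i. the (x i)) [0..<(LEAST n. x n = None)])
     else InfSeq (\<lambda>i. the (x i)))"

definition quotient_topology :: "'a topology \<Rightarrow> ('a \<Rightarrow> 'b) \<Rightarrow> 'b topology"
  where "quotient_topology T f =
    topology (\<lambda>U. U \<subseteq> f ` topspace T \<and> openin T {x \<in> topspace T. f x \<in> U})"

lemma openin_quotient_topology: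
  "openin (quotient_topology T f) U \<longleftrightarrow>
    U \<subseteq> f ` topspace T \<and> openin T {x \<in> topspace T. f x \<in> U}"
proof -
  have "istopology (\<lambda>U. U \<subseteq> f ` topspace T \<and> openin T {x \<in> topspace T. f x \<in> U})"
    unfolding istopology_def
  proof (intro conjI allI impI)
    fix S U
    assume S: "S \<subseteq> f ` topspace T \<and> openin T {x \<in> topspace T. f x \<in> S}"
      and U: "U \<subseteq> f ` topspace T \<and> openin T {x \<in> topspace T. f x \<in> U}"
    then show "S \<inter> U \<subseteq> f ` topspace T"
      by blast
    have "{x \<in> topspace T. f x \<in> S \<inter> U} =
        {x \<in> topspace T. f x \<in> S} \<inter> {x \<in> topspace T. f x \<in> U}"
      by blast
    with S U show "openin T {x \<in> topspace T. f x \<in> S \<inter> U}"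
      by auto
  next
    fix K
    assume K: "\<forall>U\<in>K. U \<subseteq> f ` topspace T \<and> openin T {x \<in> topspace T. f x \<in> U}"
    then show "\<Union>K \<subseteq> f ` topspace T"
      by blast
    have "{x \<in> topspace T. f x \<in> \<Union>K} = (\<Union>U\<in>K. {x \<in> topspace T. f x \<in> U})"
      by blast
    with K show "openin T {x \<in> topspace T. f x \<in> \<Union>K}"
      by auto
  qed
  then show ?thesis
    by (simp add: quotient_topology_def topology_inverse')
qed

lemma topspace_quotient_topology: "topspace (quotient_topology T f) = f ` topspace T"
proof -
  have "{x \<in> topspace T. f x \<in> f ` topspace T} = topspace T"
    by blast
  then have "openin (quotient_topology T f) (f ` topspace T)"
    by (simp add: openin_quotient_topology)
  then show ?thesis
    by (metis openin_quotient_topology openin_subset openin_topspace subset_antisym)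
qed

text \<open>
  For finite \<open>A\<close> the map \<^const>\<open>InfSeq\<close> is injective, so the quotient topology merely transports
  the product topology along it.
\<close>

definition full_shift_topology :: "'a set \<Rightarrow> 'a sequence topology"
  where "full_shift_topology A =
    (if finite A
     then quotient_topology (product_topology (\<lambda>_. discrete_topology A) UNIV) InfSeq
     else quotient_topology (extended_shift_topology A) truncate_seq)"

definition infinite_extension_property :: "'a set \<Rightarrow> 'a sequence set \<Rightarrow> bool"
  where "infinite_extension_property A X \<longleftrightarrow>
    (\<forall>w. FinSeq w \<in> X \<longrightarrow>
      infinite {a \<in> A. \<exists>y\<in>full_shift A. concat_seq (w @ [a]) y \<in> X})"

definition shift_space :: "'a set \<Rightarrow> 'a sequence set \<Rightarrow> bool"
  where "shift_space A X \<longleftrightarrow>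
    X \<subseteq> full_shift A \<and> closedin (full_shift_topology A) X \<and> shift_map ` X \<subseteq> X \<and>
    infinite_extension_property A X"

definition inf_part :: "'a set \<Rightarrow> 'a sequence set \<Rightarrow> 'a sequence set"
  where "inf_part A X = X \<inter> inf_seqs A"

definition fin_part :: "'a set \<Rightarrow> 'a sequence set \<Rightarrow> 'a sequence set"
  where "fin_part A X = X \<inter> fin_seqs A"

text \<open>The set of symbols occurring in elements of \<open>X\<close>, usually written \<open>B\<^sub>1(X)\<close>.\<close>

definition symbols_of :: "'a sequence set \<Rightarrow> 'a set"
  where "symbols_of X = (\<Union>x\<in>X. symbols x)"

definition finite_symbol :: "'a sequence set \<Rightarrow> bool"
  where "finite_symbol X \<longleftrightarrow> finite (symbols_of X)"

lemma topspace_full_shift_topology: "topspace (full_shift_topology A) = full_shift A"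
proof (cases "finite A")
  case True
  then show ?thesis
    by (auto simp: full_shift_topology_def full_shift_def inf_seqs_def
        topspace_quotient_topology PiE_UNIV_domain)
next
  case False
  let ?E = "{x. \<forall>n. x n \<in> insert None (Some ` A)}"
  have E: "topspace (extended_shift_topology A) = ?E"
    by (auto simp: extended_shift_topology_def PiE_UNIV_domain)
  have sub: "truncate_seq x \<in> inf_seqs A \<union> fin_seqs A" if x: "x \<in> ?E" for x
  proof (cases "\<exists>n. x n = None")
    case True
    have "the (x i) \<in> A" if "i < (LEAST n. x n = None)" for i
    proof -
      from x have "x i \<in> insert None (Some ` A)" by blast
      moreover from not_less_Least[OF that] have "x i \<noteq> None" .
      ultimately show ?thesis by auto
    qed
    then have "set (map (\<lambda>i. the (x i)) [0..<(LEAST n. x n = None)]) \<subseteq> A"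
      by auto
    with True show ?thesis
      unfolding truncate_seq_def fin_seqs_def by simp
  next
    case False
    have "the (x i) \<in> A" for i
    proof -
      from x have "x i \<in> insert None (Some ` A)" by blast
      moreover from False have "x i \<noteq> None" by metis
      ultimately show ?thesis by auto
    qed
    then have "InfSeq (\<lambda>i. the (x i)) \<in> inf_seqs A"
      unfolding inf_seqs_def by blast
    then show ?thesis
      unfolding truncate_seq_def if_not_P[OF False] by blast
  qed
  have inf: "InfSeq y \<in> truncate_seq ` ?E" if "range y \<subseteq> A" for y
  proof
    show "InfSeq y = truncate_seq (\<lambda>n. Some (y n))"
      by (simp add: truncate_seq_def)
    show "(\<lambda>n. Some (y n)) \<in> ?E"
      using that by auto
  qed
  have fin: "FinSeq w \<in> truncate_seq ` ?E" if w: "set w \<subseteq> A" for w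
  proof
    define x where "x = (\<lambda>n. if n < length w then Some (w ! n) else None)"
    have L: "(LEAST n. x n = None) = length w"
      by (rule Least_equality) (auto simp: x_def split: if_splits)
    have N: "\<exists>n. x n = None"
      by (rule exI[of _ "length w"]) (simp add: x_def)
    have "map (\<lambda>i. the (x i)) [0..<length w] = w"
      by (rule nth_equalityI) (simp_all add: x_def)
    then show "FinSeq w = truncate_seq x"
      unfolding truncate_seq_def if_P[OF N] L by (rule arg_cong[OF sym])
    have "x n \<in> insert None (Some ` A)" for n
      using w by (simp add: x_def image_iff) (metis nth_mem subsetD)
    then show "x \<in> ?E"
      by blast
  qed
  have "truncate_seq ` ?E = inf_seqs A \<union> fin_seqs A"
  proof (rule subset_antisym)
    show "truncate_seq ` ?E \<subseteq> inf_seqs A \<union> fin_seqs A"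
      by (rule image_subsetI) (rule sub)
    show "inf_seqs A \<union> fin_seqs A \<subseteq> truncate_seq ` ?E"
      unfolding inf_seqs_def fin_seqs_def
      by (intro Un_least image_subsetI) (blast intro: inf fin)+
  qed
  then show ?thesis
    unfolding full_shift_topology_def full_shift_def if_not_P[OF False]
      topspace_quotient_topology E .
qed

end

theory Submission
  imports Defs
begin

text \<open>
  The product of compactified alphabets is compact, so the first coordinates of the preimage of a
  closed set \<open>C\<close> of sequences form a compact set, which avoids \<open>\<infinity>\<close> and hence is finite unless \<open>C\<close>
  contains the empty sequence. Taking for \<open>C\<close> the shift space itself shows that it is
  finite-symbol if it omits the empty sequence. Taking for \<open>C\<close> the complement of a neighbourhood
  \<open>U\<close> of the empty sequence shows that \<open>U\<close> contains all sequences beginning with one of cofinitely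
  many symbols; if the shift space contains the empty sequence, the infinite-extension property
  provides one of its sequences in \<open>U\<close>, and repeated extension makes that sequence infinite.
\<close>

section \<open>Truncation and padding\<close>

text \<open>A section of \<open>truncate_seq\<close>: a finite word is followed by infinity forever.
  It supplies the preimage on which closed sets pulled back to the product are tested.\<close>

fun pad_seq :: "'a sequence \<Rightarrow> nat \<Rightarrow> 'a option"
  where
    "pad_seq (FinSeq w) = (\<lambda>n. if n < length w then Some (w ! n) else None)"
  | "pad_seq (InfSeq y) = (\<lambda>n. Some (y n))"

lemma truncate_pad_seq [simp]: "truncate_seq (pad_seq s) = s"
proof (cases s)
  case (FinSeq w)
  have least: "(LEAST n. pad_seq s n = None) = length w"
    by (rule Least_equality) (auto simp: FinSeq split: if_splits)
  have ex: "\<exists>n. pad_seq s n = None"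
    by (rule exI[of _ "length w"]) (simp add: FinSeq)
  have "map (\<lambda>i. the (pad_seq s i)) [0..<length w] = w"
    by (rule nth_equalityI) (simp_all add: FinSeq)
  then show ?thesis
    unfolding truncate_seq_def if_P[OF ex] least by (simp add: FinSeq)
qed (simp add: truncate_seq_def)

lemma topspace_extended_shift_topology:
  "topspace (extended_shift_topology A) = {x. \<forall>n. x n \<in> insert None (Some ` A)}"
  by (auto simp: extended_shift_topology_def PiE_UNIV_domain)

lemma pad_seq_in_topspace:
  assumes "s \<in> full_shift A"
  shows "pad_seq s \<in> topspace (extended_shift_topology A)"
proof (cases s)
  case (FinSeq w)
  then have "set w \<subseteq> A"
    using assms by (auto simp: full_shift_def fin_seqs_def inf_seqs_def split: if_splits)
  then show ?thesis
    using FinSeq nth_mem by (fastforce simp: topspace_extended_shift_topology)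
next
  case (InfSeq y)
  then show ?thesis
    using assms
    by (auto simp: topspace_extended_shift_topology full_shift_def fin_seqs_def inf_seqs_def
        split: if_splits)
qed

lemma truncate_seq_None_eq: "x 0 = None \<Longrightarrow> truncate_seq x = empty_seq"
  unfolding truncate_seq_def by (subst Least_eq_0) auto

section \<open>Compactness and first symbols\<close>

lemma compact_space_extended_shift_topology: "compact_space (extended_shift_topology A)"
  unfolding extended_shift_topology_def by (simp add: compact_space_product_topology)

lemma closedin_truncate_seq_vimage:
  assumes "infinite A" "closedin (full_shift_topology A) C"
  shows "closedin (extended_shift_topology A)
    {x \<in> topspace (extended_shift_topology A). truncate_seq x \<in> C}"
proof -
  let ?E = "extended_shift_topology A"
  have top: "topspace (full_shift_topology A) = truncate_seq ` topspace ?E"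
    using assms(1) by (simp add: full_shift_topology_def topspace_quotient_topology)
  have "openin (full_shift_topology A) (topspace (full_shift_topology A) - C)"
    using assms(2) by blast
  then have "openin ?E
      {x \<in> topspace ?E. truncate_seq x \<in> topspace (full_shift_topology A) - C}"
    using assms(1) by (simp add: full_shift_topology_def openin_quotient_topology)
  moreover have "{x \<in> topspace ?E. truncate_seq x \<in> topspace (full_shift_topology A) - C} =
      topspace ?E - {x \<in> topspace ?E. truncate_seq x \<in> C}"
    using top by blast
  ultimately show ?thesis
    by (simp add: closedin_def)
qed

text \<open>Away from \<open>None\<close> the singletons \<open>{Some a}\<close> are open and cover
  \<open>K\<close>; a finite subcover bounds \<open>K\<close>.\<close>

lemma finite_compactin_Alexandroff_discrete:
  assumes "compactin (Alexandroff_compactification (discrete_topology A)) K" "None \<notin> K"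
  shows "finite K"
proof -
  have sub: "K \<subseteq> Some ` A"
    using compactin_subset_topspace[OF assms(1)] assms(2) by auto
  have "openin (Alexandroff_compactification (discrete_topology A)) U"
    if "U \<in> (\<lambda>a. {Some a}) ` A" for U
    using that by (auto simp: openin_Alexandroff_compactification intro!: exI[of _ "{_}"])
  moreover have "K \<subseteq> \<Union> ((\<lambda>a. {Some a}) ` A)"
    using sub by blast
  ultimately obtain \<F> where "finite \<F>" "\<F> \<subseteq> (\<lambda>a. {Some a}) ` A" "K \<subseteq> \<Union>\<F>"
    using assms(1) unfolding compactin_def by meson
  moreover from this have "finite (\<Union>\<F>)"
    by blast
  ultimately show ?thesis
    by (meson finite_subset)
qed

lemma finite_first_symbols:
  assumes "infinite A" "closedin (full_shift_topology A) C" "empty_seq \<notin> C"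
  shows "finite {a. \<exists>y. concat_seq [a] y \<in> C}"
proof -
  let ?E = "extended_shift_topology A"
  define K where "K = {x \<in> topspace ?E. truncate_seq x \<in> C}"
  have "compactin ?E K"
    unfolding K_def
    using closedin_truncate_seq_vimage[OF assms(1,2)] compact_space_extended_shift_topology
    by (rule closedin_compact_space[rotated])
  moreover have "continuous_map ?E (Alexandroff_compactification (discrete_topology A)) (\<lambda>x. x 0)"
    unfolding extended_shift_topology_def by (rule continuous_map_product_projection) simp
  ultimately have "compactin (Alexandroff_compactification (discrete_topology A)) ((\<lambda>x. x 0) ` K)"
    by (rule image_compactin)
  moreover have "None \<notin> (\<lambda>x. x 0) ` K"
    using assms(3) by (auto simp: K_def dest!: truncate_seq_None_eq[OF sym])
  ultimately have fin: "finite ((\<lambda>x. x 0) ` K)"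
    by (rule finite_compactin_Alexandroff_discrete)
  \<comment> \<open>The padded sequence is the point of \<open>K\<close> with first coordinate
    \<open>Some a\<close>; membership in \<open>C\<close> puts its symbols in
    \<open>A\<close>.\<close>
  have "Some a \<in> (\<lambda>x. x 0) ` K" if "concat_seq [a] y \<in> C" for a y
  proof
    show "Some a = pad_seq (concat_seq [a] y) 0"
      by (cases y) auto
    have "concat_seq [a] y \<in> full_shift A"
      using closedin_subset[OF assms(2)] that by (auto simp: topspace_full_shift_topology)
    then show "pad_seq (concat_seq [a] y) \<in> K"
      using that by (simp add: K_def pad_seq_in_topspace)
  qed
  then have "Some ` {a. \<exists>y. concat_seq [a] y \<in> C} \<subseteq> (\<lambda>x. x 0) ` K"
    by blast
  with fin have "finite (Some ` {a. \<exists>y. concat_seq [a] y \<in> C})"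
    by (rule rev_finite_subset)
  then show ?thesis
    by (rule finite_imageD) simp
qed

section \<open>Infinite sequences as limits of finite ones\<close>

text \<open>The padded prefixes converge coordinatewise to the padded \<open>y\<close>, and the
  preimage of \<open>C\<close> is closed in the product.\<close>

lemma InfSeq_mem_closedin:
  assumes "infinite A" "closedin (full_shift_topology A) C"
    and prefixes: "\<And>n. \<exists>m\<ge>n. FinSeq (map y [0..<m]) \<in> C"
  shows "InfSeq y \<in> C"
proof (rule ccontr)
  assume notin: "InfSeq y \<notin> C"
  let ?E = "extended_shift_topology A"
  let ?K = "{x \<in> topspace ?E. truncate_seq x \<in> C}"
  have C: "C \<subseteq> full_shift A"
    using closedin_subset[OF assms(2)] by (simp add: topspace_full_shift_topology)
  have "y n \<in> A" for n
  proof -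
    obtain m where "m \<ge> Suc n" "FinSeq (map y [0..<m]) \<in> C"
      using prefixes by blast
    moreover from this have "FinSeq (map y [0..<m]) \<in> fin_seqs A"
      using C assms(1) by (auto simp: full_shift_def inf_seqs_def)
    then have "set (map y [0..<m]) \<subseteq> A"
      unfolding fin_seqs_def by blast
    ultimately show ?thesis
      by auto
  qed
  then have "InfSeq y \<in> full_shift A"
    by (auto simp: full_shift_def inf_seqs_def)
  then have y: "pad_seq (InfSeq y) \<in> topspace ?E - ?K"
    using notin pad_seq_in_topspace truncate_pad_seq by (metis (no_types, lifting) DiffI mem_Collect_eq)
  have "openin ?E (topspace ?E - ?K)"
    using closedin_truncate_seq_vimage[OF assms(1,2)] by blast
  \<comment> \<open>A basic box around \<open>y\<close> restricts only coordinates below some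
    \<open>n\<close>. A prefix of length \<open>m \<ge> n\<close> agrees with \<open>y\<close>
    there, and its padding is unrestricted, so it lies in the box.\<close>
  then obtain U where finU: "finite {i. U i \<noteq> topspace (Alexandroff_compactification (discrete_topology A))}"
    and yU: "pad_seq (InfSeq y) \<in> Pi\<^sub>E UNIV U" and U: "Pi\<^sub>E UNIV U \<subseteq> topspace ?E - ?K"
    using y unfolding extended_shift_topology_def openin_product_topology_alt by simp blast
  obtain n where n: "\<And>i. i \<ge> n \<Longrightarrow> U i = topspace (Alexandroff_compactification (discrete_topology A))"
    using finite_nat_set_iff_bounded[THEN iffD1, OF finU] by (metis (mono_tags) leD mem_Collect_eq)
  obtain m where m: "m \<ge> n" "FinSeq (map y [0..<m]) \<in> C"
    using prefixes by blast
  let ?x = "pad_seq (FinSeq (map y [0..<m]))"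
  have top: "?x \<in> topspace ?E"
    using m(2) C pad_seq_in_topspace by blast
  have "?x i \<in> U i" for i
  proof (cases "i < n")
    case True
    then have "?x i = pad_seq (InfSeq y) i"
      using m(1) by simp
    then show ?thesis
      using yU by (metis PiE_mem UNIV_I)
  next
    case False
    then show ?thesis
      using top n by (auto simp: topspace_extended_shift_topology)
  qed
  then have "?x \<in> Pi\<^sub>E UNIV U"
    by (simp add: PiE_UNIV_domain)
  then have "?x \<notin> ?K"
    using U by blast
  then show False
    using m(2) top truncate_pad_seq by (metis (no_types, lifting) mem_Collect_eq)
qed

lemma extending_chain_limit:
  fixes v :: "nat \<Rightarrow> 'a list"
  assumes "\<And>n. \<exists>u. u \<noteq> [] \<and> v (Suc n) = v n @ u"
  obtains y where "\<And>n. v n = map y [0..<length (v n)]" "\<And>n. n \<le> length (v n)"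
proof
  \<comment> \<open>Every step adds a letter, so \<open>v (Suc i)\<close> has length at least
    \<open>Suc i\<close> and entry \<open>i\<close> is settled there; \<open>v i\<close> may be too
    short.\<close>
  define y where "y = (\<lambda>i. v (Suc i) ! i)"
  have len: "n \<le> length (v n)" for n
  proof (induction n)
    case (Suc n)
    obtain u where "u \<noteq> []" "v (Suc n) = v n @ u"
      using assms by blast
    then show ?case
      using Suc by (cases u) auto
  qed simp
  then show "n \<le> length (v n)" for n .
  have mono: "\<exists>u. v m = v n @ u" if "n \<le> m" for n m
    using that
  proof (induction m rule: dec_induct)
    case (step m)
    then show ?case
      using assms[of m] by force
  qed simp
  show "v n = map y [0..<length (v n)]" for n
  proof (rule nth_equalityI)
    fix i
    assume i: "i < length (v n)"
    have i': "i < length (v (Suc i))"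
      using len[of "Suc i"] by simp
    have "v n ! i = v (Suc i) ! i"
    proof (cases "n \<le> Suc i")
      case True
      then obtain u where "v (Suc i) = v n @ u"
        using mono by blast
      then show ?thesis
        using i by (simp add: nth_append)
    next
      case False
      then obtain u where "v n = v (Suc i) @ u"
        using mono[of "Suc i" n] by auto
      then show ?thesis
        using i' by (simp add: nth_append)
    qed
    then show "v n ! i = map y [0..<length (v n)] ! i"
      using i by (simp add: y_def)
  qed simp
qed

lemma concat_seq_append: "concat_seq (v @ w) y = concat_seq v (concat_seq w y)"
  by (cases y) (auto simp: nth_append intro!: ext)

text \<open>The infinite-extension property appends a letter and some tail. If no such tail is
  infinite, iterating gives a strictly growing chain of words in \<open>X\<close>, whose limit lies
  in \<open>X\<close> by closedness.\<close>

lemma infinite_extension_exists: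
  assumes "infinite A" "shift_space A X" "FinSeq w \<in> X"
  shows "\<exists>y. concat_seq w (InfSeq y) \<in> X"
proof (rule ccontr)
  assume none: "\<nexists>y. concat_seq w (InfSeq y) \<in> X"
  \<comment> \<open>Keeping \<open>w\<close> as a prefix lets an infinite tail at any later stage
    contradict \<open>none\<close>.\<close>
  let ?P = "\<lambda>v. FinSeq v \<in> X \<and> (\<exists>u. v = w @ u)"
  have step: "\<exists>v'. ?P v' \<and> (\<exists>u. u \<noteq> [] \<and> v' = v @ u)" if P: "?P v" for v
  proof -
    have "infinite {a \<in> A. \<exists>y\<in>full_shift A. concat_seq (v @ [a]) y \<in> X}"
      using assms(2) P by (simp add: shift_space_def infinite_extension_property_def)
    then obtain a y where ay: "concat_seq (v @ [a]) y \<in> X"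
      using not_finite_existsD by blast
    obtain u where u: "v = w @ u"
      using P by blast
    show ?thesis
    proof (cases y)
      case (FinSeq t)
      then show ?thesis
        using ay u by (intro exI[of _ "v @ a # t"]) simp
    next
      case (InfSeq t)
      have "concat_seq w (concat_seq (u @ [a]) y) \<in> X"
        using ay u by (simp flip: concat_seq_append)
      then show ?thesis
        using none InfSeq by auto
    qed
  qed
  obtain v where v: "\<And>n. ?P (v n)" "\<And>n. \<exists>u. u \<noteq> [] \<and> v (Suc n) = v n @ u"
    using dependent_nat_choice[of "\<lambda>_. ?P" "\<lambda>_ x x'. \<exists>u. u \<noteq> [] \<and> x' = x @ u"] step assms(3)
    by (metis (no_types, lifting) append_Nil2)
  obtain y where y: "\<And>n. v n = map y [0..<length (v n)]" "\<And>n. n \<le> length (v n)"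
    using extending_chain_limit[of v] v(2) by blast
  have "InfSeq y \<in> X"
  proof (rule InfSeq_mem_closedin[OF assms(1)])
    show "closedin (full_shift_topology A) X"
      using assms(2) by (simp add: shift_space_def)
    show "\<exists>m\<ge>n. FinSeq (map y [0..<m]) \<in> X" for n
      using v(1)[of n] y[of n] by metis
  qed
  \<comment> \<open>The chain starts at some extension of \<open>w\<close>, not necessarily at
    \<open>w\<close>; its first word \<open>v 0\<close> is a prefix of \<open>y\<close>, so
    \<open>w\<close> is too.\<close>
  moreover have "InfSeq y = concat_seq w (InfSeq (\<lambda>i. y (i + length w)))"
  proof -
    obtain u where "v 0 = w @ u"
      using v(1) by blast
    then have "y i = w ! i" if "i < length w" for i
      using y(1)[of 0] that
      by (metis add_0 length_append nth_append nth_map_upt diff_zero trans_less_add1)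
    then show ?thesis
      by auto
  qed
  ultimately show False
    using none by metis
qed

section \<open>Symbols and iterated shifts\<close>

lemma funpow_shift_map_InfSeq: "(shift_map ^^ n) (InfSeq x) = InfSeq (\<lambda>i. x (i + n))"
  by (induction n) simp_all

lemma funpow_shift_map_FinSeq: "(shift_map ^^ n) (FinSeq w) = FinSeq (drop n w)"
  by (induction n) (simp_all add: drop_Suc tl_drop)

text \<open>Deleting everything before an occurrence of \<open>a\<close> moves it to the front. In a
  shift-invariant set every symbol is thus a first symbol, within reach of
  \<open>finite_first_symbols\<close>.\<close>

lemma symbols_shift_first:
  assumes "a \<in> symbols s"
  shows "\<exists>n y. (shift_map ^^ n) s = concat_seq [a] y"
proof (cases s)
  case (FinSeq w)
  then obtain n where "n < length w" "w ! n = a"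
    using assms by (auto simp: in_set_conv_nth)
  then have "(shift_map ^^ n) s = concat_seq [a] (FinSeq (drop (Suc n) w))"
    by (auto simp: FinSeq funpow_shift_map_FinSeq Cons_nth_drop_Suc)
  then show ?thesis
    by blast
next
  case (InfSeq x)
  then obtain n where "x n = a"
    using assms by auto
  then have "(shift_map ^^ n) s = concat_seq [a] (InfSeq (\<lambda>i. x (Suc (i + n))))"
    by (auto simp: InfSeq funpow_shift_map_InfSeq)
  then show ?thesis
    by blast
qed

lemma funpow_shift_map_mem:
  assumes "shift_map ` X \<subseteq> X" "s \<in> X"
  shows "(shift_map ^^ n) s \<in> X"
  using assms by (induction n) auto

lemma finite_symbol_if_empty_seq_notin:
  assumes "infinite A" "shift_space A X" "empty_seq \<notin> X"
  shows "finite_symbol X"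
proof -
  have X: "closedin (full_shift_topology A) X" "shift_map ` X \<subseteq> X"
    using assms(2) by (auto simp: shift_space_def)
  have "symbols_of X \<subseteq> {a. \<exists>y. concat_seq [a] y \<in> X}"
  proof
    fix a
    assume "a \<in> symbols_of X"
    then obtain s where "s \<in> X" "a \<in> symbols s"
      by (auto simp: symbols_of_def)
    then show "a \<in> {a. \<exists>y. concat_seq [a] y \<in> X}"
      using symbols_shift_first[of a s] funpow_shift_map_mem[OF X(2)] by (metis mem_Collect_eq)
  qed
  then show ?thesis
    using finite_first_symbols[OF assms(1) X(1) assms(3)]
    by (simp add: finite_symbol_def finite_subset)
qed

text \<open>Each of the infinitely many letters that may follow \<open>w\<close> occurs in an
  element of \<open>X\<close>.\<close>

lemma infinite_symbols_if_FinSeq_mem: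
  assumes "infinite_extension_property A X" "FinSeq w \<in> X"
  shows "\<not> finite_symbol X"
proof -
  have "a \<in> symbols (concat_seq (w @ [a]) y)" for a y
  proof (cases y)
    case (InfSeq x)
    \<comment> \<open>The entry of the concatenation at index \<open>length w\<close>;
      \<open>x 0\<close> comes from truncated subtraction in the branch not taken.\<close>
    have "a = (if length w < length (w @ [a]) then (w @ [a]) ! length w else x 0)"
      by simp
    then show ?thesis
      by (auto simp: InfSeq image_iff intro!: exI[of _ "length w"])
  qed simp
  then have "{a \<in> A. \<exists>y\<in>full_shift A. concat_seq (w @ [a]) y \<in> X} \<subseteq> symbols_of X"
    by (auto simp: symbols_of_def)
  then show ?thesis
    using assms finite_subset unfolding infinite_extension_property_def finite_symbol_def by blast
qed

section \<open>The empty sequence as a limit point\<close>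

lemma empty_seq_in_derived_set_of:
  assumes "infinite A" "shift_space A X" "empty_seq \<in> X"
  shows "empty_seq \<in> full_shift_topology A derived_set_of inf_part A X"
proof -
  let ?T = "full_shift_topology A"
  have X: "X \<subseteq> full_shift A" "infinite_extension_property A X"
    using assms(2) by (auto simp: shift_space_def)
  have "\<exists>s. s \<noteq> empty_seq \<and> s \<in> inf_part A X \<and> s \<in> U"
    if U: "empty_seq \<in> U" "openin ?T U" for U
  proof -
    have "closedin ?T (topspace ?T - U)"
      using U(2) by blast
    then have "finite {a. \<exists>y. concat_seq [a] y \<in> topspace ?T - U}"
      using finite_first_symbols[OF assms(1)] U(1) by blast
    moreover have "infinite {a \<in> A. \<exists>y\<in>full_shift A. concat_seq [a] y \<in> X}"
      using X(2)[unfolded infinite_extension_property_def, rule_format, OF assms(3)] by simp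
    ultimately have "\<not> {a \<in> A. \<exists>y\<in>full_shift A. concat_seq [a] y \<in> X} \<subseteq>
        {a. \<exists>y. concat_seq [a] y \<in> topspace ?T - U}"
      using finite_subset by blast
    \<comment> \<open>The letter \<open>a\<close> keeps every continuation \<open>z\<close> out of
      the complement of \<open>U\<close>, so the tail \<open>y\<close> can be exchanged for an
      infinite one without leaving \<open>U\<close>.\<close>
    then obtain a y where a: "\<And>z. concat_seq [a] z \<notin> topspace ?T - U"
      and ay: "concat_seq [a] y \<in> X"
      by blast
    obtain z where z: "concat_seq [a] (InfSeq z) \<in> X"
    proof (cases y)
      case (FinSeq w)
      then obtain t where "concat_seq ([a] @ w) (InfSeq t) \<in> X"
        using infinite_extension_exists[OF assms(1,2)] ay by (metis concat_seq.simps(1))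
      moreover obtain t' where "concat_seq w (InfSeq t) = InfSeq t'"
        by simp
      ultimately show ?thesis
        using that by (metis concat_seq_append)
    qed (use ay that in blast)
    then have "concat_seq [a] (InfSeq z) \<in> U"
      using a X(1) unfolding topspace_full_shift_topology by blast
    moreover have "concat_seq [a] (InfSeq z) \<in> inf_part A X"
      using z X(1) by (auto simp: inf_part_def full_shift_def fin_seqs_def split: if_splits)
    ultimately show ?thesis
      by (metis concat_seq.simps(2) sequence.distinct(1))
  qed
  then show ?thesis
    using assms(3) X(1) by (auto simp: in_derived_set_of topspace_full_shift_topology)
qed

section \<open>Equivalence of the six conditions\<close>

theorem proposition3p19:
  fixes A :: "'a set" and X :: "'a sequence set"
  assumes "shift_space A X"
  shows
    "(finite_symbol X \<longleftrightarrow> fin_part A X = {}) \<and>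
     (fin_part A X = {} \<longleftrightarrow> X = inf_part A X) \<and>
     (X = inf_part A X \<longleftrightarrow> closedin (full_shift_topology A) (inf_part A X)) \<and>
     (closedin (full_shift_topology A) (inf_part A X) \<longleftrightarrow>
        empty_seq \<notin> full_shift_topology A derived_set_of inf_part A X) \<and>
     (empty_seq \<notin> full_shift_topology A derived_set_of inf_part A X \<longleftrightarrow> empty_seq \<notin> X)"
proof -
  have X: "X \<subseteq> full_shift A" "closedin (full_shift_topology A) X" "shift_map ` X \<subseteq> X"
    "infinite_extension_property A X"
    using assms by (auto simp: shift_space_def)
  have fin_iff_inf: "fin_part A X = {} \<longleftrightarrow> X = inf_part A X"
    using X(1) by (auto simp: fin_part_def inf_part_def full_shift_def fin_seqs_def inf_seqs_def
        split: if_splits)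
  have mem_fin_part: "\<exists>w. s = FinSeq w \<and> FinSeq w \<in> X" if "s \<in> fin_part A X" for s
    using that by (auto simp: fin_part_def fin_seqs_def)
  have empty_if_fin: "empty_seq \<in> X" if "fin_part A X \<noteq> {}"
  proof -
    from that obtain s where "s \<in> fin_part A X"
      by blast
    then obtain w where "FinSeq w \<in> X"
      using mem_fin_part by blast
    \<comment> \<open>Shifting \<open>w\<close> by its own length leaves the empty sequence.\<close>
    then show ?thesis
      using funpow_shift_map_mem[OF X(3), of "FinSeq w" "length w"]
      by (simp add: funpow_shift_map_FinSeq)
  qed
  have empty_fin_part: "empty_seq \<in> fin_part A X" if "empty_seq \<in> X"
    using that by (simp add: fin_part_def fin_seqs_def)
  have fin_if_symbol: "fin_part A X = {}" if "finite_symbol X"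
    using that mem_fin_part infinite_symbols_if_FinSeq_mem[OF X(4)] by blast
  have symbol_if_empty: "finite_symbol X" if "empty_seq \<notin> X"
  proof (cases "finite A")
    case True
    then have "symbols_of X \<subseteq> A"
      using X(1) by (fastforce simp: symbols_of_def full_shift_def inf_seqs_def)
    with True show ?thesis
      by (simp add: finite_symbol_def finite_subset)
  next
    case False
    then show ?thesis
      using finite_symbol_if_empty_seq_notin assms that by blast
  qed
  have derived: "empty_seq \<in> full_shift_topology A derived_set_of inf_part A X \<longleftrightarrow> empty_seq \<in> X"
  proof
    assume "empty_seq \<in> full_shift_topology A derived_set_of inf_part A X"
    then have "empty_seq \<in> full_shift_topology A derived_set_of X"
      using derived_set_of_mono[of "inf_part A X" X] by (auto simp: inf_part_def)
    then show "empty_seq \<in> X"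
      using X(2) by (auto simp: closedin_contains_derived_set)
  next
    \<comment> \<open>Over a finite alphabet the full shift has no finite sequences, so
      \<open>A\<close> is infinite here.\<close>
    assume "empty_seq \<in> X"
    moreover from this have "infinite A"
      using X(1) by (auto simp: full_shift_def inf_seqs_def)
    ultimately show "empty_seq \<in> full_shift_topology A derived_set_of inf_part A X"
      using empty_seq_in_derived_set_of assms by blast
  qed
  \<comment> \<open>A closed set contains its limit points, but \<open>empty_seq\<close> is not
    infinite. Conversely, \<open>X = inf_part A X\<close> makes the infinite part closed because
    \<open>X\<close> is.\<close>
  have "empty_seq \<notin> full_shift_topology A derived_set_of inf_part A X"
    if "closedin (full_shift_topology A) (inf_part A X)"
    using that by (auto simp: closedin_contains_derived_set inf_part_def inf_seqs_def)
  then show ?thesis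
    using X(2) fin_iff_inf empty_if_fin empty_fin_part fin_if_symbol symbol_if_empty derived
    by (metis empty_iff)
qed

end
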